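(* Let $b\ge 2$ and $\rho\ge 1$ be integers, and let $r\ge 1$ be a fixed real number. For each $i=1,2,\ldots,\rho$ let $(z_{i,1},z_{i,2},\ldots)$ be an infinite sequence of parameters with $|z_{i,j}|\le r^j$ for all $j\ge 1$, and let $Z$ denote the collection of all $z_{i,j}$. Let the sequence $C_b^\rho(n;Z)$, $n\ge 0$, be defined by $$\sum_{n=0}^\infty C_b^\rho(n;Z)q^n=\prod_{j=0}^\infty\prod_{i=1}^\rho\left(1+z_{i,1}q^{b^j}+z_{i,2}q^{2\cdot b^j}+z_{i,3}q^{3\cdot b^j}+\cdots\right),$$ and let the sequence $Y_n(Z)$, $n\ge 0$, be defined by $$\sum_{n=0}^\infty Y_n(Z)q^n=\prod_{i=1}^\rho\left(1+z_{i,1}q+z_{i,2}q^2+z_{i,3}q^3+\cdots\right).$$ Then $C_b^\rho(0;Z)=1$, and for all integers $n\ge 0$, $$C_b^\rho(bn+j;Z)=\sum_{k=0}^nY_{bk+j}(Z)\,C_b^\rho(n-k;Z)\qquad (j=0,1,\ldots,b-1).$$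
   Context: The parameters $z_{i,j}$ are complex numbers. The generating functions are power series in $q$ (the sums and products converge for $|q|<1/r$), and the sequences are defined by their coefficients. *)

theory Defs
  imports "HOL-Analysis.Analysis"
begin

text \<open>
  Only the values of \<open>z i m\<close> with \<open>i \<ge> 1\<close> and \<open>m \<ge> 1\<close> are parameters;
  the constant term of each series is 1, whatever \<open>z i 0\<close> is.
\<close>

definition param_series :: "(nat \<Rightarrow> nat \<Rightarrow> complex) \<Rightarrow> nat \<Rightarrow> complex fps" where
  "param_series z i = Abs_fps (\<lambda>m. if m = 0 then 1 else z i m)"

text \<open>
  The infinite product over \<open>j\<close> is the library's \<^const>\<open>prodinf\<close>, taken in the usual
  (\<open>q\<close>-adic) topology of formal power series. Substituting \<open>q ^ (b ^ j)\<close> for \<open>q\<close> is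
  composition with \<open>fps_X ^ (b ^ j)\<close>.
\<close>

definition C_gf :: "nat \<Rightarrow> nat \<Rightarrow> (nat \<Rightarrow> nat \<Rightarrow> complex) \<Rightarrow> complex fps" where
  "C_gf b \<rho> z = (\<Prod>j. \<Prod>i=1..\<rho>. fps_compose (param_series z i) (fps_X ^ (b ^ j)))"

definition C_seq :: "nat \<Rightarrow> nat \<Rightarrow> (nat \<Rightarrow> nat \<Rightarrow> complex) \<Rightarrow> nat \<Rightarrow> complex" where
  "C_seq b \<rho> z n = fps_nth (C_gf b \<rho> z) n"

definition Y_gf :: "nat \<Rightarrow> (nat \<Rightarrow> nat \<Rightarrow> complex) \<Rightarrow> complex fps" where
  "Y_gf \<rho> z = (\<Prod>i=1..\<rho>. param_series z i)"

definition Y_seq :: "nat \<Rightarrow> (nat \<Rightarrow> nat \<Rightarrow> complex) \<Rightarrow> nat \<Rightarrow> complex" where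
  "Y_seq \<rho> z n = fps_nth (Y_gf \<rho> z) n"

end

theory Submission
  imports Defs "HOL-Computational_Algebra.Formal_Laurent_Series"
begin

text \<open>
  Write \<open>F(q)\<close> for the generating function of \<open>Y\<close> and \<open>L(q)\<close> for that of \<open>C\<close>. Substitution
  respects products, so \<open>L(q)\<close> is the product of \<open>F(q ^ (b ^ j))\<close> over \<open>j \<ge> 0\<close>. The factor
  for \<open>j = 0\<close> is \<open>F(q)\<close> itself, and the remaining factors form the same product in the variable
  \<open>q ^ b\<close>. Hence \<open>L(q) = F(q) L(q ^ b)\<close> (lemma \<open>dilation_prodinf_functional_eq\<close>). The series
  \<open>L(q ^ b)\<close> has coefficient \<open>C m\<close> at \<open>b m\<close> and is zero off the multiples of \<open>b\<close>, so
  comparing coefficients at \<open>b n + j\<close> gives the recurrence (lemma \<open>nth_mult_compose_X_power\<close>).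

  Since \<open>F\<close> has constant term 1, the \<open>j\<close>-th factor is 1 up to terms of degree at least
  \<open>b ^ j > j\<close>. Each coefficient of the partial products is therefore eventually constant, which
  is \<open>q\<close>-adic convergence; the functional equation passes from the partial products to the limit
  one coefficient at a time.
\<close>

unbundle no vec_syntax
unbundle fps_syntax

lemma compose_X_power_nth_below:
  fixes F :: "'a :: idom fps"
  assumes "0 < m" "m < d"
  shows "(F oo fps_X ^ d) $ m = 0"
  using assms nat_dvd_not_less[of m d] by (simp add: fps_nth_compose_X_power)

text \<open>
  The factor with index \<open>Suc N\<close> has no terms of positive degree at most \<open>Suc N\<close>, so multiplying
  by it leaves the coefficients up to \<open>Suc N\<close> alone; the bound \<open>n \<le> N\<close> is enough for the limit.
\<close>

lemma dilation_partial_prod_nth_stable: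
  fixes F :: "'a :: idom fps"
  assumes F0: "F $ 0 = 1" and b: "b \<ge> 2" and "n \<le> N"
  shows "(\<Prod>j\<le>N. F oo fps_X ^ (b ^ j)) $ n = (\<Prod>j\<le>n. F oo fps_X ^ (b ^ j)) $ n"
  using \<open>n \<le> N\<close>
proof (induction N rule: dec_induct)
  case (step N)
  let ?P = "\<Prod>j\<le>N. F oo fps_X ^ (b ^ j)" and ?G = "F oo fps_X ^ (b ^ Suc N)"
  have small: "n < b ^ Suc N"
    using step.hyps b power_gt_expt[of b "Suc N"] by linarith
  have "(?P * ?G) $ n = (\<Sum>i=0..n. if i = n then ?P $ i else 0)"
    unfolding fps_mult_nth
  proof (intro sum.cong refl)
    fix i assume i: "i \<in> {0..n}"
    show "?P $ i * ?G $ (n - i) = (if i = n then ?P $ i else 0)"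
    proof (cases "i = n")
      case False
      then have "?G $ (n - i) = 0"
        using i small by (intro compose_X_power_nth_below) auto
      then show ?thesis using False by simp
    qed (simp add: F0)
  qed
  then show ?case using step.IH by simp
qed simp

lemma dilation_partial_prod_Suc:
  fixes F :: "'a :: idom fps"
  assumes "b > 0"
  shows "(\<Prod>j\<le>Suc N. F oo fps_X ^ (b ^ j)) =
    F * ((\<Prod>j\<le>N. F oo fps_X ^ (b ^ j)) oo fps_X ^ b)"
proof -
  have factor: "F oo fps_X ^ (b ^ Suc j) = (F oo fps_X ^ (b ^ j)) oo fps_X ^ b" for j
  proof -
    have "fps_X ^ (b ^ j) oo fps_X ^ b = (fps_X ^ b :: 'a fps) ^ (b ^ j)"
      using assms by (subst fps_compose_power[symmetric]) auto
    then show ?thesis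
      using assms by (subst fps_compose_assoc[symmetric]) (auto simp flip: power_mult)
  qed
  have "(\<Prod>j\<le>Suc N. F oo fps_X ^ (b ^ j)) =
    (F oo fps_X ^ (b ^ 0)) * (\<Prod>j\<le>N. F oo fps_X ^ (b ^ Suc j))"
    by (rule prod.atMost_Suc_shift)
  also have "(\<Prod>j\<le>N. F oo fps_X ^ (b ^ Suc j)) = (\<Prod>j\<le>N. F oo fps_X ^ (b ^ j)) oo fps_X ^ b"
    using assms by (simp only: factor) (subst fps_compose_prod_distrib, auto)
  finally show ?thesis by simp
qed

lemma dilation_has_prod:
  fixes F :: "'a :: idom fps"
  assumes F0: "F $ 0 = 1" and b: "b \<ge> 2"
  shows "(\<lambda>j. F oo fps_X ^ (b ^ j)) has_prod
    Abs_fps (\<lambda>n. (\<Prod>j\<le>n. F oo fps_X ^ (b ^ j)) $ n)"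
proof -
  let ?P = "\<lambda>N. \<Prod>j\<le>N. F oo fps_X ^ (b ^ j)"
  let ?L = "Abs_fps (\<lambda>n. ?P n $ n)"
  have "?P \<longlonglongrightarrow> ?L"
  proof (rule tendsto_fpsI)
    fix n
    show "eventually (\<lambda>N. ?P N $ n = ?L $ n) sequentially"
      using eventually_ge_at_top[of n]
    proof eventually_elim
      case (elim N)
      then have "?P N $ n = ?P n $ n" by (rule dilation_partial_prod_nth_stable[OF F0 b])
      then show ?case unfolding fps_nth_Abs_fps .
    qed
  qed
  \<comment> \<open>A product tending to 0 would not count as convergent.\<close>
  moreover have "?L $ 0 = 1" by (simp add: F0)
  then have "?L \<noteq> 0" by force
  ultimately show ?thesis by (simp add: has_prod_def raw_has_prod_def)
qed

lemma dilation_prodinf_nth: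
  fixes F :: "'a :: idom fps"
  assumes "F $ 0 = 1" "b \<ge> 2" "n \<le> N"
  shows "(\<Prod>j. F oo fps_X ^ (b ^ j)) $ n = (\<Prod>j\<le>N. F oo fps_X ^ (b ^ j)) $ n"
proof -
  have "(\<Prod>j. F oo fps_X ^ (b ^ j)) $ n = (\<Prod>j\<le>n. F oo fps_X ^ (b ^ j)) $ n"
    unfolding has_prod_unique[OF dilation_has_prod[OF assms(1,2)], symmetric] fps_nth_Abs_fps ..
  also have "\<dots> = (\<Prod>j\<le>N. F oo fps_X ^ (b ^ j)) $ n"
    by (rule dilation_partial_prod_nth_stable[OF assms, symmetric])
  finally show ?thesis .
qed

lemma dilation_prodinf_functional_eq:
  fixes F :: "'a :: idom fps" and b :: nat
  assumes F0: "F $ 0 = 1" and b: "b \<ge> 2"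
  defines "L \<equiv> \<Prod>j. F oo fps_X ^ (b ^ j)"
  shows "L = F * (L oo fps_X ^ b)"
proof (rule fps_ext)
  fix n
  let ?P = "\<Prod>j\<le>n. F oo fps_X ^ (b ^ j)"
  have "L $ m = ?P $ m" if "m \<le> n" for m
    unfolding L_def by (rule dilation_prodinf_nth[OF F0 b that])
  then have inner: "(L oo fps_X ^ b) $ m = (?P oo fps_X ^ b) $ m" if "m \<le> n" for m
    using b that by (simp add: fps_nth_compose_X_power le_trans[OF div_le_dividend])
  \<comment> \<open>One factor more than stability requires, so that splitting off \<open>F\<close> leaves \<open>?P\<close>.\<close>
  have "L $ n = (\<Prod>j\<le>Suc n. F oo fps_X ^ (b ^ j)) $ n"
    unfolding L_def by (rule dilation_prodinf_nth[OF F0 b]) simp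
  also have "\<dots> = (F * (?P oo fps_X ^ b)) $ n"
    using b by (subst dilation_partial_prod_Suc) auto
  also have "\<dots> = (F * (L oo fps_X ^ b)) $ n"
    unfolding fps_mult_nth by (intro sum.cong refl) (simp add: inner)
  finally show "L $ n = (F * (L oo fps_X ^ b)) $ n" .
qed

text \<open>
  Only the multiples \<open>b i\<close> with \<open>b i \<le> b n + j\<close>, that is \<open>i \<le> n\<close>, contribute to the
  convolution; they are listed as \<open>i = n - k\<close>.
\<close>

lemma nth_mult_compose_X_power:
  fixes F L :: "'a :: idom fps"
  assumes "j < b"
  shows "(F * (L oo fps_X ^ b)) $ (b * n + j) = (\<Sum>k=0..n. F $ (b * k + j) * L $ (n - k))"
proof -
  let ?M = "b * n + j"
  let ?h = "\<lambda>m. F $ m * (L oo fps_X ^ b) $ (?M - m)"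
  have b: "b > 0" using assms by simp
  have "(F * (L oo fps_X ^ b)) $ ?M = (\<Sum>m\<in>{0..?M}. ?h m)"
    by (simp add: fps_mult_nth)
  also have "\<dots> = (\<Sum>m\<in>(\<lambda>k. b * k + j) ` {0..n}. ?h m)"
  proof (intro sum.mono_neutral_right ballI)
    fix m assume m: "m \<in> {0..?M} - (\<lambda>k. b * k + j) ` {0..n}"
    have "\<not> b dvd ?M - m"
    proof
      assume "b dvd ?M - m"
      then obtain i where i: "?M - m = b * i" by blast
      then have "b * i \<le> b * n + j" by linarith
      also have "\<dots> < b * Suc n" using assms by simp
      finally have "i \<le> n" by (simp only: mult_less_cancel1 less_Suc_eq_le)
      moreover have "m = b * (n - i) + j"
        using i m \<open>i \<le> n\<close> mult_le_mono2[OF \<open>i \<le> n\<close>, of b] by (auto simp: diff_mult_distrib2)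
      ultimately show False using m by auto
    qed
    then show "?h m = 0" using b by (simp add: fps_nth_compose_X_power)
  qed auto
  also have "\<dots> = (\<Sum>k=0..n. ?h (b * k + j))"
    using b by (subst sum.reindex) (auto simp: inj_on_def)
  also have "\<dots> = (\<Sum>k=0..n. F $ (b * k + j) * L $ (n - k))"
  proof (intro sum.cong refl)
    fix k
    have "?M - (b * k + j) = b * (n - k)" by (simp add: diff_mult_distrib2)
    then show "?h (b * k + j) = F $ (b * k + j) * L $ (n - k)"
      using b by (simp add: fps_nth_compose_X_power)
  qed
  finally show ?thesis .
qed

lemma Y_gf_nth_0: "Y_gf \<rho> z $ 0 = 1"
proof -
  have "(\<Prod>i\<in>A. param_series z i) $ 0 = 1" for A
    by (induction A rule: infinite_finite_induct) (simp_all add: param_series_def)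
  then show ?thesis by (simp add: Y_gf_def)
qed

lemma C_gf_eq_dilation_prodinf:
  assumes "b > 0"
  shows "C_gf b \<rho> z = (\<Prod>j. Y_gf \<rho> z oo fps_X ^ (b ^ j))"
  using assms by (simp add: C_gf_def Y_gf_def fps_compose_prod_distrib)

theorem proposition5p4:
  fixes b \<rho> :: nat and r :: real and z :: "nat \<Rightarrow> nat \<Rightarrow> complex"
  assumes "b \<ge> 2" and "\<rho> \<ge> 1" and "r \<ge> 1"
    and "\<And>i j. i \<in> {1..\<rho>} \<Longrightarrow> j \<ge> 1 \<Longrightarrow> norm (z i j) \<le> r ^ j"
  shows "C_seq b \<rho> z 0 = 1 \<and>
    (\<forall>n. \<forall>j<b. C_seq b \<rho> z (b * n + j) =
       (\<Sum>k=0..n. Y_seq \<rho> z (b * k + j) * C_seq b \<rho> z (n - k)))"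
proof -
  let ?Y = "Y_gf \<rho> z" and ?C = "C_gf b \<rho> z"
  have C: "?C = (\<Prod>j. ?Y oo fps_X ^ (b ^ j))"
    using assms(1) by (intro C_gf_eq_dilation_prodinf) simp
  have "?C $ 0 = 1"
    using dilation_prodinf_nth[OF Y_gf_nth_0 assms(1), of 0 0] by (simp add: C Y_gf_nth_0)
  moreover have feq: "?C = ?Y * (?C oo fps_X ^ b)"
    unfolding C by (rule dilation_prodinf_functional_eq[OF Y_gf_nth_0 assms(1)])
  have "?C $ (b * n + j) = (\<Sum>k=0..n. ?Y $ (b * k + j) * ?C $ (n - k))" if "j < b" for n j
    by (subst feq) (rule nth_mult_compose_X_power[OF that])
  ultimately show ?thesis by (simp add: C_seq_def Y_seq_def)
qed

end
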